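(* Partitions $\mu$ and $\nu$ are rook equivalent if and only if $w_k(\mu)=w_k(\nu)$ for all positive integers $k$.
   Context: Partitions are identified with Ferrers boards; box $(i,j)$ is in row $i$ from the top and column $j$ from the left. Two partitions are rook equivalent if for every $k\ge0$ they have the same number of placements of $k$ non-attacking rooks (no two in the same row or column). An $L$ in $\mu$ is a set of boxes obtained by choosing a box $(i,j)$ of $\mu$ (its corner) and taking all boxes $(i,x)$ of $\mu$ with $x\ge j$ together with all boxes $(y,j)$ with $y\le i$. A nested sequence of $L$'s in $\mu$ is a sequence $L_1,\dots,L_k$ of $L$'s in $\mu$ such that for $1\le c<d\le k$ the corner of $L_d$ is strictly above and strictly to the right of the corner of $L_c$. Its weight is the total number of boxes in all the $L$'s (counted per $L$). $w_k(\mu)$ is the maximum weight of a nested sequence of $k$ $L$'s in $\mu$. *)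

theory Defs
  imports Main
begin

definition is_partition :: "nat list \<Rightarrow> bool" where
  "is_partition \<mu> \<longleftrightarrow> sorted_wrt (\<ge>) \<mu> \<and> (\<forall>p \<in> set \<mu>. 0 < p)"

text \<open>Boxes are numbered from 1, as pairs (row, column); list indices start at 0.\<close>

definition ferrers :: "nat list \<Rightarrow> (nat \<times> nat) set" where
  "ferrers \<mu> = {(i, j). 1 \<le> i \<and> i \<le> length \<mu> \<and> 1 \<le> j \<and> j \<le> \<mu> ! (i - 1)}"

definition non_attacking :: "(nat \<times> nat) set \<Rightarrow> bool" where
  "non_attacking R \<longleftrightarrow> (\<forall>a \<in> R. \<forall>b \<in> R. a \<noteq> b \<longrightarrow> fst a \<noteq> fst b \<and> snd a \<noteq> snd b)"

definition rook_number :: "nat list \<Rightarrow> nat \<Rightarrow> nat" where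
  "rook_number \<mu> k = card {R. R \<subseteq> ferrers \<mu> \<and> card R = k \<and> non_attacking R}"

definition rook_equivalent :: "nat list \<Rightarrow> nat list \<Rightarrow> bool" where
  "rook_equivalent \<mu> \<nu> \<longleftrightarrow> (\<forall>k. rook_number \<mu> k = rook_number \<nu> k)"

definition L_shape :: "nat list \<Rightarrow> nat \<times> nat \<Rightarrow> (nat \<times> nat) set" where
  "L_shape \<mu> c =
     {(i, x). (i, x) \<in> ferrers \<mu> \<and> i = fst c \<and> snd c \<le> x} \<union>
     {(y, j). (y, j) \<in> ferrers \<mu> \<and> j = snd c \<and> y \<le> fst c}"

text \<open>Rows are numbered downwards, so strictly above means a strictly smaller first
  coordinate. An L in \<open>\<mu>\<close> determines its corner (its leftmost box in its lowest row),
  so quantifying over the list of corners below introduces no ambiguity.\<close>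

definition nested_Ls :: "nat list \<Rightarrow> (nat \<times> nat) set list \<Rightarrow> bool" where
  "nested_Ls \<mu> Ls \<longleftrightarrow>
     (\<exists>cs. set cs \<subseteq> ferrers \<mu> \<and> Ls = map (L_shape \<mu>) cs \<and>
           sorted_wrt (\<lambda>a b. fst b < fst a \<and> snd a < snd b) cs)"

definition nested_weight :: "(nat \<times> nat) set list \<Rightarrow> nat" where
  "nested_weight Ls = (\<Sum>L \<leftarrow> Ls. card L)"

text \<open>If \<open>\<mu>\<close> has no nested sequence of \<open>k\<close> L's, the value is 0. Since every L is nonempty,
  for \<open>k \<ge> 1\<close> the value 0 occurs only in this case.\<close>

definition max_nested_weight :: "nat \<Rightarrow> nat list \<Rightarrow> nat" where
  "max_nested_weight k \<mu> =
     (let W = {nested_weight Ls | Ls. nested_Ls \<mu> Ls \<and> length Ls = k}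
      in if W = {} then 0 else Max W)"

end

theory Submission
  imports Defs "HOL-Computational_Algebra.Polynomial"
begin

text \<open>
  Number rows and columns from 0 and let \<open>a i\<close> be the length of row \<open>i\<close> plus \<open>i\<close>, after
  appending empty rows so that both partitions have \<open>N\<close> rows. By Goldman, Joichi and White the
  rook numbers amount to the polynomial \<open>\<Prod>i<N. x + a i - (N - 1)\<close>, hence to the multiset of the
  \<open>a i\<close>, hence to the numbers \<open>d s\<close> of boxes on the antidiagonals \<open>i + j = s\<close>.

  The L with corner \<open>(i, j)\<close> meets each antidiagonal \<open>s\<close> with \<open>j \<le> s < a i\<close> exactly once and no
  other, and nested L's are disjoint, so \<open>k\<close> of them weigh at most \<open>\<Sum>s. min k (d s)\<close>. This bound is
  attained as soon as \<open>k\<close> nested L's exist, that is, when \<open>d (k - 1) = k\<close>: put the corners into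
  the first \<open>k\<close> columns and into the \<open>k\<close> rows with the largest \<open>a i\<close> among those rows whose value
  \<open>a i\<close> occurs again further down.

  Conversely \<open>{s. k \<le> d s}\<close> is an interval starting at \<open>k - 1\<close> whose length is the difference
  of the maximal weights for \<open>k\<close> and \<open>k - 1\<close>, so the weights determine \<open>d\<close>.
\<close>

subsection \<open>Rook numbers\<close>

lemma finite_ferrers: "finite (ferrers \<mu>)"
proof -
  have "ferrers \<mu> \<subseteq> (SIGMA i:{1..length \<mu>}. {1..\<mu> ! (i - 1)})"
    by (auto simp: ferrers_def)
  then show ?thesis
    by (rule finite_subset) auto
qed

lemma finite_placements: "finite {R. R \<subseteq> ferrers \<mu> \<and> card R = k \<and> non_attacking R}"
  by (rule finite_subset[of _ "Pow (ferrers \<mu>)"]) (auto simp: finite_ferrers)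

lemma rook_number_0: "rook_number \<mu> 0 = 1"
proof -
  have "{R. R \<subseteq> ferrers \<mu> \<and> card R = 0 \<and> non_attacking R} = {{}}"
    by (auto simp: non_attacking_def card_eq_0_iff dest: finite_subset[OF _ finite_ferrers])
  then show ?thesis
    by (simp add: rook_number_def)
qed

lemma rook_number_eq_0:
  assumes "length \<mu> < k"
  shows "rook_number \<mu> k = 0"
proof -
  have "card R \<le> length \<mu>" if "R \<subseteq> ferrers \<mu>" "non_attacking R" for R
  proof -
    have "inj_on fst R"
      using that(2) unfolding non_attacking_def inj_on_def by blast
    moreover have "fst ` R \<subseteq> {1..length \<mu>}"
      using that(1) by (auto simp: ferrers_def)
    ultimately show ?thesis
      using card_inj_on_le[of fst R "{1..length \<mu>}"] by simp
  qed
  then have "{R. R \<subseteq> ferrers \<mu> \<and> card R = k \<and> non_attacking R} = {}"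
    unfolding Collect_empty_eq using assms by (metis leD)
  then show ?thesis
    by (simp only: rook_number_def card.empty)
qed

section \<open>Removing the top row of a board\<close>

lemma ferrers_Cons:
  "ferrers (p # ps) = Pair 1 ` {1..p} \<union> map_prod Suc id ` ferrers ps"
proof -
  have mem: "(i, j) \<in> map_prod Suc id ` ferrers ps \<longleftrightarrow> (\<exists>i'. i = Suc i' \<and> (i', j) \<in> ferrers ps)" for i j
    by (force simp: image_iff)
  have mem1: "(i, j) \<in> Pair 1 ` {1..p} \<longleftrightarrow> i = 1 \<and> 1 \<le> j \<and> j \<le> p" for i j :: nat
    by auto
  have "(i, j) \<in> ferrers (p # ps) \<longleftrightarrow> (i, j) \<in> Pair 1 ` {1..p} \<union> map_prod Suc id ` ferrers ps" for i j
    unfolding Un_iff mem mem1 by (cases i) (auto simp: ferrers_def nth_Cons')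
  then show ?thesis
    by auto
qed

lemma non_attacking_pair:
  "non_attacking R \<Longrightarrow> (i, j) \<in> R \<Longrightarrow> (i', j') \<in> R \<Longrightarrow> i = i' \<longleftrightarrow> j = j'"
  unfolding non_attacking_def by (metis fst_conv snd_conv)

lemma inj_shift: "inj (map_prod Suc id :: nat \<times> nat \<Rightarrow> nat \<times> nat)"
  by (simp add: prod.inj_map)

lemma non_attacking_shift:
  "non_attacking (map_prod Suc id ` R) \<longleftrightarrow> non_attacking R"
  by (simp add: non_attacking_def inj_eq[OF inj_shift])

lemma card_shift: "card (map_prod Suc id ` (R :: (nat \<times> nat) set)) = card R"
  by (rule card_image) (rule inj_on_subset[OF inj_shift subset_UNIV])

text \<open>A placement either avoids the top row or has one rook there and \<open>k\<close> rooks
  below. The lower rooks block \<open>k\<close> distinct columns of the top row, which is the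
  longest, so \<open>p - k\<close> remain. Integers are used because \<open>p < k\<close> can occur;
  then the factor \<open>rook_number ps k\<close> vanishes.\<close>

lemma rook_number_Cons:
  assumes "sorted_wrt (\<ge>) (p # ps)"
  shows "int (rook_number (p # ps) (Suc k)) =
    int (rook_number ps (Suc k)) + (int p - int k) * int (rook_number ps k)"
proof -
  define Q where "Q \<mu> k = {R. R \<subseteq> ferrers \<mu> \<and> card R = k \<and> non_attacking R}" for \<mu> k
  \<comment> \<open>\<open>sh\<close> moves a placement on \<open>ps\<close> below a new top row;
    \<open>g\<close> also adds a rook in column \<open>j\<close> of that row, and \<open>E\<close>
    holds the pairs in which this column is free.\<close>
  define sh :: "(nat \<times> nat) set \<Rightarrow> (nat \<times> nat) set" where "sh R = map_prod Suc id ` R" for R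
  define g where "g = (\<lambda>(R, j). insert (1 :: nat, j :: nat) (sh R))"
  define E where "E = (SIGMA R:Q ps k. {1..p} - snd ` R)"
  have inj_sh: "inj sh"
    unfolding sh_def by (rule injI) (simp add: inj_image_eq_iff[OF inj_shift])
  have fin: "finite (Q ps k)" "finite (Q ps (Suc k))" for k
    by (auto simp: Q_def finite_placements)
  have finE: "finite E"
    unfolding E_def by (intro finite_SigmaI fin) simp
  have no1: "(Suc 0, j) \<notin> sh R" if "R \<subseteq> ferrers ps" for R j
    using that by (auto simp: sh_def ferrers_def)
  have col: "snd ` R \<subseteq> {1..p}" if "R \<subseteq> ferrers ps" for R
  proof
    fix j assume "j \<in> snd ` R"
    then obtain i where "(i, j) \<in> ferrers ps"
      using \<open>R \<subseteq> ferrers ps\<close> by auto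
    then have "1 \<le> j" "j \<le> ps ! (i - 1)" "ps ! (i - 1) \<in> set ps"
      by (auto simp: ferrers_def)
    then show "j \<in> {1..p}"
      using assms by fastforce
  qed
  have finR: "finite R" if "R \<subseteq> ferrers ps" for R
    using that finite_ferrers finite_subset by blast
  have split: "Q (p # ps) (Suc k) = sh ` Q ps (Suc k) \<union> g ` E"
  proof (intro equalityI subsetI)
    fix R assume "R \<in> Q (p # ps) (Suc k)"
    then have R: "R \<subseteq> Pair 1 ` {1..p} \<union> map_prod Suc id ` ferrers ps" "card R = Suc k" "non_attacking R"
      by (auto simp: Q_def ferrers_Cons)
    define R' where "R' = {x \<in> ferrers ps. map_prod Suc id x \<in> R}"
    have R'sub: "R' \<subseteq> ferrers ps" by (auto simp: R'_def)
    have sh_R': "sh R' = R \<inter> map_prod Suc id ` ferrers ps"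
    proof -
      have "g ` {x \<in> F. g x \<in> R} = R \<inter> g ` F" for g :: "nat \<times> nat \<Rightarrow> nat \<times> nat" and F
        by auto
      then show ?thesis unfolding sh_def R'_def .
    qed
    show "R \<in> sh ` Q ps (Suc k) \<union> g ` E"
    proof (cases "\<exists>j. (1, j) \<in> R")
      case False
      then have eq: "R = sh R'"
        using R(1) unfolding sh_R' by blast
      then have "R' \<in> Q ps (Suc k)"
        using R R'sub by (auto simp: Q_def sh_def card_shift non_attacking_shift)
      with eq show ?thesis by blast
    next
      case True
      then obtain j where j: "(1, j) \<in> R" by blast
      have uniq: "j' = j" if "(Suc 0, j') \<in> R" for j'
        using non_attacking_pair[OF R(3) that] j by auto
      have eq: "R = insert (1, j) (sh R')"
      proof
        show "R \<subseteq> insert (1, j) (sh R')"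
        proof
          fix x assume x: "x \<in> R"
          show "x \<in> insert (1, j) (sh R')"
          proof (cases "x \<in> map_prod Suc id ` ferrers ps")
            case False
            then obtain j' where "x = (1, j')" using R(1) x by blast
            then show ?thesis using uniq[of j'] x by simp
          qed (simp add: sh_R' x)
        qed
      qed (use j sh_R' in blast)
      have "card R' = k"
        using R(2) no1[OF R'sub, of j] finR[OF R'sub] unfolding eq
        by (simp add: sh_def card_shift)
      moreover have "non_attacking R'"
      proof -
        have "non_attacking (sh R')"
          using R(3) unfolding eq by (auto simp: non_attacking_def)
        then show ?thesis by (simp add: sh_def non_attacking_shift)
      qed
      moreover have "j \<notin> snd ` R'"
      proof
        assume "j \<in> snd ` R'"
        then obtain i where "(i, j) \<in> R'" by auto
        then have "(Suc i, j) \<in> R" "i \<ge> 1"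
          using R'sub by (auto simp: R'_def ferrers_def)
        then show False
          using non_attacking_pair[OF R(3) j, of "Suc i" j] by simp
      qed
      moreover have "j \<in> {1..p}"
        using R(1) j no1[of "ferrers ps" j] by (auto simp: sh_def)
      ultimately have "(R', j) \<in> E"
        using R'sub by (auto simp: E_def Q_def)
      then show ?thesis
        using eq by (force simp: g_def)
    qed
  next
    fix R assume "R \<in> sh ` Q ps (Suc k) \<union> g ` E"
    then consider R' where "R = sh R'" "R' \<in> Q ps (Suc k)" | R' j where "(R', j) \<in> E" "R = g (R', j)"
      by auto
    then show "R \<in> Q (p # ps) (Suc k)"
    proof cases
      case 1
      then show ?thesis
        by (auto simp: Q_def sh_def card_shift non_attacking_shift ferrers_Cons)
    next
      case 2
      then have R': "R' \<subseteq> ferrers ps" "card R' = k" "non_attacking R'" "j \<in> {1..p}" "j \<notin> snd ` R'"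
        by (auto simp: E_def Q_def)
      have R: "R = insert (1, j) (sh R')" using 2 by (simp add: g_def)
      have "card R = Suc k"
        using R'(2) no1[OF R'(1), of j] finR[OF R'(1)] unfolding R
        by (simp add: sh_def card_shift)
      moreover have "non_attacking R"
      proof -
        have "non_attacking (sh R')" using R'(3) by (simp add: sh_def non_attacking_shift)
        moreover have "fst x \<noteq> 1 \<and> snd x \<noteq> j" if "x \<in> sh R'" for x
          using that R'(1,5) no1[OF R'(1)] by (force simp: sh_def ferrers_def)
        ultimately show ?thesis
          unfolding R non_attacking_def by force
      qed
      moreover have "R \<subseteq> ferrers (p # ps)"
        using R'(1,4) unfolding R ferrers_Cons by (auto simp: sh_def)
      ultimately show ?thesis by (simp add: Q_def)
    qed
  qed
  have inj_g: "inj_on g E"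
  proof (rule inj_onI, clarify)
    fix R j R' j' assume *: "(R, j) \<in> E" "(R', j') \<in> E" "g (R, j) = g (R', j')"
    then have sub: "R \<subseteq> ferrers ps" "R' \<subseteq> ferrers ps" by (auto simp: E_def Q_def)
    have eq: "insert (1, j) (sh R) = insert (1, j') (sh R')" using *(3) by (simp add: g_def)
    have "j = j'" using eq no1[OF sub(1)] no1[OF sub(2)] by auto
    moreover have "sh R = sh R'"
      using eq no1[OF sub(1), of j] no1[OF sub(2), of j] \<open>j = j'\<close>
      by (metis One_nat_def insert_ident)
    then have "R = R'" using inj_sh by (auto dest: injD)
    ultimately show "R = R' \<and> j = j'" by simp
  qed
  have "sh ` Q ps (Suc k) \<inter> g ` E = {}"
  proof -
    have "sh R \<noteq> g x" if "R \<in> Q ps (Suc k)" for R x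
      using no1[of R "snd x"] that by (auto simp: g_def Q_def split: prod.splits)
    then show ?thesis by blast
  qed
  then have "card (Q (p # ps) (Suc k)) = card (Q ps (Suc k)) + card E"
    unfolding split using fin finE
    by (simp add: card_Un_disjoint card_image[OF inj_g] card_image[OF inj_on_subset[OF inj_sh subset_UNIV]])
  moreover have "int (card E) = (int p - int k) * int (card (Q ps k))"
  proof -
    have "int (card ({1..p} - snd ` R)) = int p - int k" if "R \<in> Q ps k" for R
    proof -
      have R: "R \<subseteq> ferrers ps" "card R = k" "non_attacking R" using that by (auto simp: Q_def)
      have "inj_on snd R"
        using R(3) unfolding non_attacking_def inj_on_def by blast
      then have ck: "card (snd ` R) = k" by (simp add: card_image R(2))
      have "k \<le> p" using card_mono[OF _ col[OF R(1)]] ck by simp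
      then show ?thesis
        using card_Diff_subset[OF _ col[OF R(1)]] finR[OF R(1)] ck by simp
    qed
    then have "int (card E) = (\<Sum>R\<in>Q ps k. int p - int k)"
      unfolding E_def using fin by (subst card_SigmaI) auto
    then show ?thesis by simp
  qed
  ultimately show ?thesis
    by (simp add: rook_number_def Q_def)
qed

section \<open>Rook numbers as coefficients of falling factorials (Goldman, Joichi and
  White)\<close>

definition ffact :: "int \<Rightarrow> nat \<Rightarrow> int" where
  "ffact x m = (\<Prod>i<m. x - int i)"

text \<open>Induction on the rows. With \<open>n = length ps\<close>, the part without a rook in the
  top row contributes a factor \<open>x - (n - k)\<close> to the \<open>k\<close>-th term and the
  part with one contributes \<open>p - k\<close>. Their sum \<open>x + p - n\<close> does not depend
  on \<open>k\<close> and factors out.\<close>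

lemma goldman_joichi_white:
  assumes "sorted_wrt (\<ge>) \<mu>"
  shows "(\<Sum>k\<le>length \<mu>. int (rook_number \<mu> k) * ffact x (length \<mu> - k)) =
    (\<Prod>i<length \<mu>. x + 1 + int (\<mu> ! i + i) - int (length \<mu>))"
  using assms
proof (induction \<mu>)
  case Nil
  then show ?case by (simp add: ffact_def rook_number_0)
next
  case (Cons p ps)
  let ?N = "length ps"
  let ?r = "\<lambda>k. int (rook_number ps k)"
  have "(\<Sum>k\<le>Suc ?N. int (rook_number (p # ps) k) * ffact x (Suc ?N - k)) =
    (ffact x (Suc ?N) + (\<Sum>k\<le>?N. ?r (Suc k) * ffact x (?N - k))) +
    (\<Sum>k\<le>?N. (int p - int k) * ?r k * ffact x (?N - k))"
    by (subst sum.atMost_Suc_shift)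
      (simp add: rook_number_0 rook_number_Cons[OF Cons.prems] algebra_simps sum.distrib sum_subtractf)
  also have "ffact x (Suc ?N) + (\<Sum>k\<le>?N. ?r (Suc k) * ffact x (?N - k)) =
    (\<Sum>k\<le>Suc ?N. ?r k * ffact x (Suc ?N - k))"
    by (subst sum.atMost_Suc_shift) (simp add: rook_number_0)
  also have "\<dots> = (\<Sum>k\<le>?N. ?r k * ffact x (Suc ?N - k))"
    by (simp add: rook_number_eq_0)
  also have "\<dots> = (\<Sum>k\<le>?N. ?r k * (ffact x (?N - k) * (x - int (?N - k))))"
    by (intro sum.cong) (auto simp: Suc_diff_le ffact_def)
  also have "\<dots> + (\<Sum>k\<le>?N. (int p - int k) * ?r k * ffact x (?N - k)) =
    (\<Sum>k\<le>?N. (x + int p - int ?N) * (?r k * ffact x (?N - k)))"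
    unfolding sum.distrib[symmetric]
    by (intro sum.cong) (auto simp: of_nat_diff algebra_simps)
  also have "\<dots> = (x + int p - int ?N) * (\<Prod>i<?N. x + 1 + int (ps ! i + i) - int ?N)"
    using Cons by (simp add: sum_distrib_left[symmetric])
  also have "\<dots> = (\<Prod>i<Suc ?N. x + 1 + int ((p # ps) ! i + i) - int (Suc ?N))"
    by (subst prod.lessThan_Suc_shift) (simp add: algebra_simps)
  finally show ?case by simp
qed

text \<open>At \<open>x = m\<close> all falling factorials of degree above \<open>m\<close> vanish
  while that of degree \<open>m\<close> does not, so evaluation at 0, 1, 2, ... gives a triangular
  system.\<close>

lemma ffact_coeffs_unique:
  assumes "\<And>x. (\<Sum>m\<le>N. c m * ffact x m) = (\<Sum>m\<le>N. d m * ffact x m)" "m \<le> N"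
  shows "c m = d m"
  using assms(2)
proof (induction m rule: less_induct)
  case (less m)
  have zero: "ffact (int m) i = 0" if "i > m" for i
    using that by (force simp: ffact_def)
  have "ffact (int m) m \<noteq> 0"
    by (simp add: ffact_def)
  moreover have "(\<Sum>i\<le>N. e i * ffact (int m) i) = (\<Sum>i<m. e i * ffact (int m) i) + e m * ffact (int m) m"
    for e
  proof -
    have "(\<Sum>i\<le>N. e i * ffact (int m) i) = (\<Sum>i\<le>m. e i * ffact (int m) i)"
      using less.prems zero by (intro sum.mono_neutral_right) auto
    then show ?thesis by (simp add: lessThan_Suc_atMost[symmetric])
  qed
  moreover have "(\<Sum>i<m. c i * ffact (int m) i) = (\<Sum>i<m. d i * ffact (int m) i)"
    using less by (intro sum.cong) auto
  ultimately show ?case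
    using assms(1)[of "int m"] by simp
qed

text \<open>The root \<open>- a\<close> of the left product must be a root of some factor on the
  right; that common factor is cancelled.\<close>

lemma prod_mset_linear_inject:
  fixes A B :: "int multiset"
  assumes "(\<Prod>a\<in>#A. [:a, 1:]) = (\<Prod>a\<in>#B. [:a, 1:])"
  shows "A = B"
  using assms
proof (induction A arbitrary: B)
  case empty
  show ?case
  proof (cases B)
    case (add b B')
    then have "poly (\<Prod>a\<in>#B. [:a, 1:]) (- b) = 0" by simp
    with empty show ?thesis by (metis image_mset_empty poly_1 prod_mset_empty zero_neq_one)
  qed simp
next
  case (add a A)
  have "poly (\<Prod>a\<in>#B. [:a, 1:]) (- a) = 0"
    using add.prems[symmetric] by simp
  then have "a \<in># B"
    by (auto simp: poly_prod_mset)
  then obtain B' where B: "B = add_mset a B'" by (metis multi_member_split)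
  have "[:a, 1:] * (\<Prod>a\<in>#A. [:a, 1:]) = [:a, 1:] * (\<Prod>a\<in>#B'. [:a, 1:])"
    using add.prems unfolding B by (simp only: image_mset_add_mset prod_mset.add_mset)
  then have "(\<Prod>a\<in>#A. [:a, 1:]) = (\<Prod>a\<in>#B'. [:a, 1:])"
    by (subst (asm) mult_left_cancel) simp_all
  then show ?case
    using add.IH B by simp
qed

lemma prod_linear_eq_iff:
  fixes a b :: "nat \<Rightarrow> int"
  shows "(\<forall>x. (\<Prod>i<N. x + a i) = (\<Prod>i<N. x + b i)) \<longleftrightarrow>
    image_mset a (mset_set {..<N}) = image_mset b (mset_set {..<N})"
proof
  assume eq: "\<forall>x. (\<Prod>i<N. x + a i) = (\<Prod>i<N. x + b i)"
  have P: "poly (\<Prod>i<N. [:c i, 1:]) x = (\<Prod>i<N. x + c i)" for c :: "nat \<Rightarrow> int" and x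
    by (simp add: poly_prod add.commute)
  have "(\<Prod>i<N. [:a i, 1:]) = (\<Prod>i<N. [:b i, 1:])"
    by (subst poly_eq_poly_eq_iff[symmetric]) (simp add: P eq fun_eq_iff)
  then show "image_mset a (mset_set {..<N}) = image_mset b (mset_set {..<N})"
    by (intro prod_mset_linear_inject) (simp add: prod_unfold_prod_mset multiset.map_comp comp_def)
next
  assume eq: "image_mset a (mset_set {..<N}) = image_mset b (mset_set {..<N})"
  have "(\<Prod>i<N. x + c i) = (\<Prod>y\<in>#image_mset c (mset_set {..<N}). x + y)" for c :: "nat \<Rightarrow> int" and x
    by (simp add: prod_unfold_prod_mset multiset.map_comp comp_def)
  then show "\<forall>x. (\<Prod>i<N. x + a i) = (\<Prod>i<N. x + b i)"
    by (simp only: eq simp_thms)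
qed

text \<open>Equal rook numbers mean equal falling factorial expansions, hence equal products of
  linear factors. A common \<open>N\<close> is essential: it fixes both the degrees and the shift in
  each factor. Rows of length 0 are allowed, so padded partitions are covered.\<close>

lemma rook_equivalent_iff_mset:
  assumes "sorted_wrt (\<ge>) \<mu>" "sorted_wrt (\<ge>) \<nu>" "length \<mu> = N" "length \<nu> = N"
  shows "rook_equivalent \<mu> \<nu> \<longleftrightarrow>
    image_mset (\<lambda>i. \<mu> ! i + i) (mset_set {..<N}) = image_mset (\<lambda>i. \<nu> ! i + i) (mset_set {..<N})"
proof -
  define S where "S \<mu> x = (\<Sum>k\<le>N. int (rook_number \<mu> k) * ffact x (N - k))" for \<mu> x
  have S_rev: "S \<mu> x = (\<Sum>m\<le>N. int (rook_number \<mu> (N - m)) * ffact x m)" for \<mu> x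
    unfolding S_def by (rule sum.reindex_bij_witness[of _ "\<lambda>m. N - m" "\<lambda>m. N - m"]) auto
  have "rook_equivalent \<mu> \<nu> \<longleftrightarrow> (\<forall>x. S \<mu> x = S \<nu> x)"
  proof
    assume eq: "\<forall>x. S \<mu> x = S \<nu> x"
    show "rook_equivalent \<mu> \<nu>"
      unfolding rook_equivalent_def
    proof
      fix k
      show "rook_number \<mu> k = rook_number \<nu> k"
      proof (cases "k \<le> N")
        case True
        have "int (rook_number \<mu> (N - (N - k))) = int (rook_number \<nu> (N - (N - k)))"
          using eq by (intro ffact_coeffs_unique[where N = N and m = "N - k" and
                c = "\<lambda>m. int (rook_number \<mu> (N - m))" and d = "\<lambda>m. int (rook_number \<nu> (N - m))"])
              (simp_all add: S_rev)
        with True show ?thesis by simp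
      qed (simp add: rook_number_eq_0 assms)
    qed
  qed (simp add: rook_equivalent_def S_def)
  also have "\<dots> \<longleftrightarrow> (\<forall>x. (\<Prod>i<N. x + (1 + int (\<mu> ! i + i) - int N)) =
      (\<Prod>i<N. x + (1 + int (\<nu> ! i + i) - int N)))"
    using goldman_joichi_white[OF assms(1)] goldman_joichi_white[OF assms(2)]
    by (simp add: S_def assms algebra_simps)
  also have "\<dots> \<longleftrightarrow> image_mset (\<lambda>n. 1 + int n - int N) (image_mset (\<lambda>i. \<mu> ! i + i) (mset_set {..<N})) =
      image_mset (\<lambda>n. 1 + int n - int N) (image_mset (\<lambda>i. \<nu> ! i + i) (mset_set {..<N}))"
    by (simp only: prod_linear_eq_iff multiset.map_comp comp_def)
  also have "\<dots> \<longleftrightarrow> image_mset (\<lambda>i. \<mu> ! i + i) (mset_set {..<N}) = image_mset (\<lambda>i. \<nu> ! i + i) (mset_set {..<N})"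
    by (rule inj_eq) (intro multiset.inj_map injI, simp)
  finally show ?thesis .
qed

subsection \<open>Antidiagonals\<close>

text \<open>For \<open>a i\<close> = length of row \<open>i\<close> plus \<open>i\<close>, row \<open>i\<close> meets the antidiagonal \<open>s\<close> (in column
  \<open>s - i\<close>) iff \<open>i \<le> s < a i\<close>.\<close>

definition diag :: "(nat \<Rightarrow> nat) \<Rightarrow> nat \<Rightarrow> nat" where
  "diag a s = card {i. i \<le> s \<and> s < a i}"

lemma diag_le: "diag a s \<le> Suc s"
  unfolding diag_def using card_mono[of "{..s}" "{i. i \<le> s \<and> s < a i}"] by auto

text \<open>Antidiagonal \<open>s\<close> has \<open>Suc s\<close> places. That all of them are
  occupied says that the staircase with rows \<open>Suc s\<close>, ..., 1 fits into the
  board.\<close>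

lemma diag_full_iff: "Suc s \<le> diag a s \<longleftrightarrow> (\<forall>i\<le>s. s < a i)"
proof
  assume "Suc s \<le> diag a s"
  then have "{i. i \<le> s \<and> s < a i} = {..s}"
    using diag_le[of a s] by (intro card_subset_eq) (auto simp: diag_def)
  then show "\<forall>i\<le>s. s < a i" by blast
next
  assume "\<forall>i\<le>s. s < a i"
  then have "{i. i \<le> s \<and> s < a i} = {..s}" by auto
  then show "Suc s \<le> diag a s" by (simp add: diag_def)
qed

lemma diag_full_pred: "Suc (Suc s) \<le> diag a (Suc s) \<Longrightarrow> Suc s \<le> diag a s"
  by (simp only: diag_full_iff) (meson le_SucI lessI less_trans)

text \<open>Multiplicities are differences of consecutive tail counts; for the value 0 the total
  \<open>N\<close> takes the place of the missing tail.\<close>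

lemma image_mset_eq_iff_tails:
  fixes a b :: "nat \<Rightarrow> nat"
  shows "image_mset a (mset_set {..<N}) = image_mset b (mset_set {..<N}) \<longleftrightarrow>
    (\<forall>s. card {i. i < N \<and> s < a i} = card {i. i < N \<and> s < b i})"
proof
  assume eq: "image_mset a (mset_set {..<N}) = image_mset b (mset_set {..<N})"
  have "card {i. i < N \<and> s < c i} = size (filter_mset (\<lambda>v. s < v) (image_mset c (mset_set {..<N})))"
    for s and c :: "nat \<Rightarrow> nat"
    by (simp add: filter_mset_image_mset)
  then show "\<forall>s. card {i. i < N \<and> s < a i} = card {i. i < N \<and> s < b i}"
    by (simp only: eq simp_thms)
next
  assume eq: "\<forall>s. card {i. i < N \<and> s < a i} = card {i. i < N \<and> s < b i}"
  have cnt: "count (image_mset c (mset_set {..<N})) v = card {i. i < N \<and> c i = v}"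
    for v and c :: "nat \<Rightarrow> nat"
    by (simp add: count_image_mset vimage_def Int_def conj_commute)
  have zero: "card {i. i < N \<and> c i = 0} = N - card {i. i < N \<and> 0 < c i}" for c :: "nat \<Rightarrow> nat"
  proof -
    have "{i. i < N \<and> c i = 0} = {..<N} - {i. i < N \<and> 0 < c i}" by auto
    then show ?thesis by (simp add: card_Diff_subset subset_eq)
  qed
  have suc: "card {i. i < N \<and> c i = Suc v} = card {i. i < N \<and> v < c i} - card {i. i < N \<and> Suc v < c i}"
    for v and c :: "nat \<Rightarrow> nat"
  proof -
    have "{i. i < N \<and> c i = Suc v} = {i. i < N \<and> v < c i} - {i. i < N \<and> Suc v < c i}" by auto
    then show ?thesis by (simp add: card_Diff_subset subset_eq)
  qed
  have "card {i. i < N \<and> a i = v} = card {i. i < N \<and> b i = v}" for v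
    using eq by (cases v) (simp_all add: zero suc)
  then show "image_mset a (mset_set {..<N}) = image_mset b (mset_set {..<N})"
    by (intro multiset_eqI) (simp add: cnt)
qed

text \<open>Greedy choice of an \<open>i\<close> outside \<open>S\<close> with maximal
  \<open>a i\<close>. If \<open>s < a i\<close>, the count for \<open>S\<close> grows by one;
  otherwise nothing outside \<open>S\<close> exceeds \<open>s\<close>, so \<open>S\<close> already
  holds all such elements.\<close>

lemma top_subset:
  fixes a :: "nat \<Rightarrow> nat"
  assumes "finite T" "k \<le> card T"
  shows "\<exists>S\<subseteq>T. card S = k \<and> (\<forall>s. min k (card {i \<in> T. s < a i}) \<le> card {i \<in> S. s < a i})"
  using assms(2)
proof (induction k)
  case 0
  show ?case by (intro exI[of _ "{}"]) simp
next
  case (Suc k)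
  then obtain S where S: "S \<subseteq> T" "card S = k"
    "\<And>s. min k (card {i \<in> T. s < a i}) \<le> card {i \<in> S. s < a i}"
    by auto
  have fS: "finite S" using S(1) assms(1) finite_subset by blast
  have "T - S \<noteq> {}" using S Suc.prems by (metis Diff_eq_empty_iff antisym not_less_eq_eq order_refl)
  then have "Max (a ` (T - S)) \<in> a ` (T - S)"
    using assms(1) by (intro Max_in) auto
  moreover have "a i' \<le> Max (a ` (T - S))" if "i' \<in> T - S" for i'
    using assms(1) that by (intro Max_ge) auto
  ultimately obtain i where i: "i \<in> T - S" "\<And>i'. i' \<in> T - S \<Longrightarrow> a i' \<le> a i"
    by auto
  have "min (Suc k) (card {i \<in> T. s < a i}) \<le> card {i' \<in> insert i S. s < a i'}" for s
  proof (cases "s < a i")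
    case True
    then have "{i' \<in> insert i S. s < a i'} = insert i {i' \<in> S. s < a i'}" by auto
    then have "card {i' \<in> insert i S. s < a i'} = Suc (card {i' \<in> S. s < a i'})"
      using i(1) fS by simp
    then show ?thesis using S(3)[of s] by linarith
  next
    case False
    then have "{i \<in> T. s < a i} \<subseteq> {i' \<in> insert i S. s < a i'}"
      using i(2) by (auto simp: not_less intro: ccontr) (metis le_trans not_less)
    then have "card {i \<in> T. s < a i} \<le> card {i' \<in> insert i S. s < a i'}"
      using fS by (intro card_mono) auto
    then show ?thesis by simp
  qed
  moreover have "card (insert i S) = Suc k" using i(1) S(2) fS by simp
  ultimately show ?case using i(1) S(1) by (intro exI[of _ "insert i S"]) auto
qed

text \<open>\<open>step\<close> expresses that row lengths weakly decrease, \<open>ge\<close> that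
  they are nonnegative, \<open>tail\<close> that rows from \<open>N\<close> on are empty. By
  \<open>bound\<close>, \<open>N\<close> also exceeds every antidiagonal that meets the
  board.\<close>

locale shifted_rows =
  fixes a :: "nat \<Rightarrow> nat" and N :: nat
  assumes step: "a (Suc i) \<le> Suc (a i)"
    and ge: "i \<le> a i"
    and tail: "N \<le> i \<Longrightarrow> a i = i"
    and bound: "i < N \<Longrightarrow> a i < N"
begin

text \<open>A discrete intermediate value theorem: \<open>a\<close> rises by at most 1 per step,
  while it may fall by any amount.\<close>

lemma intermediate:
  assumes "i \<le> i'" "a i \<le> v" "v \<le> a i'"
  shows "\<exists>m. i \<le> m \<and> m \<le> i' \<and> a m = v"
  using assms(1,3)
proof (induction i' rule: dec_induct)
  case base
  with assms(2) show ?case by auto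
next
  case (step n)
  show ?case
  proof (cases "v \<le> a n")
    case True
    then show ?thesis using step.IH le_SucI by blast
  next
    case False
    then have "v = a (Suc n)" using step.prems shifted_rows.step[OF shifted_rows_axioms, of n] by simp
    then show ?thesis using step.hyps by (intro exI[of _ "Suc n"]) simp
  qed
qed

text \<open>Rows after \<open>s\<close> all satisfy \<open>s < i \<le> a i\<close>. Their number
  \<open>N - Suc s\<close> does not depend on \<open>a\<close>, so \<open>diag\<close> carries the
  same information as the tail counts.\<close>

lemma card_tail: "card {i. i < N \<and> s < a i} = diag a s + (N - Suc s)"
proof -
  have "i < N" if "i \<le> s" "s < a i" for i
    using that tail[of i] by (cases "i < N") auto
  then have "{i. i < N \<and> s < a i} = {i. i \<le> s \<and> s < a i} \<union> {s<..<N}"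
    using ge by (auto intro: less_le_trans)
  then have "card {i. i < N \<and> s < a i} = card {i. i \<le> s \<and> s < a i} + card {s<..<N}"
    by (simp add: card_Un_disjoint disjoint_iff)
  then show ?thesis by (simp add: diag_def)
qed

lemma diag_eq_0: "N \<le> s \<Longrightarrow> diag a s = 0"
proof -
  assume "N \<le> s"
  then have "\<not> (i \<le> s \<and> s < a i)" for i
    using tail[of i] bound[of i] by (cases "i < N") auto
  then show ?thesis
    by (simp add: diag_def)
qed

section \<open>Choice of the corner rows\<close>

definition repeated :: "nat set" where
  "repeated = {i. i < N \<and> (\<exists>i'. i < i' \<and> i' < N \<and> a i' = a i)}"

lemma finite_repeated: "finite repeated"
  by (simp add: repeated_def)

text \<open>As \<open>a i - i\<close> is the length of row \<open>i\<close>, the repeated rows,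
  numbered from the bottom, are long enough to have corners in successive columns.\<close>

lemma card_repeated_ge:
  assumes "i < N"
  shows "card {i' \<in> repeated. i \<le> i'} + i \<le> a i"
proof -
  define L where "L = {i'. i \<le> i' \<and> i' < N \<and> i' \<notin> repeated}"
  \<comment> \<open>From \<open>a i\<close> on, \<open>a\<close> grows by at most 1 per step and reaches \<open>N - 1\<close>, so it takes all values in
    between; \<open>L\<close> holds their last occurrences.\<close>
  have "{a i..<N} \<subseteq> a ` L"
  proof
    fix v assume v: "v \<in> {a i..<N}"
    have "i \<le> N - 1" using assms by linarith
    have "v \<le> N - 1" using v by auto
    then have "v \<le> a (N - 1)" using ge[of "N - 1"] by (rule le_trans)
    then obtain m where m: "i \<le> m" "m \<le> N - 1" "a m = v"
      using intermediate[of i "N - 1" v] v \<open>i \<le> N - 1\<close> by auto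
    define M where "M = Max {m. m < N \<and> a m = v}"
    have fin: "finite {m. m < N \<and> a m = v}" by simp
    have mem: "m \<in> {m. m < N \<and> a m = v}" using m assms by auto
    have "M \<in> {m. m < N \<and> a m = v}" unfolding M_def using fin mem by (intro Max_in) auto
    moreover have "M \<ge> i" using Max_ge[OF fin mem] m(1) unfolding M_def by simp
    moreover have "m' \<le> M" if "m' < N" "a m' = v" for m'
      using Max_ge[OF fin, of m'] that unfolding M_def by simp
    ultimately have "M \<in> L" "a M = v"
      by (auto simp: L_def repeated_def dest: leD)
    then show "v \<in> a ` L" by blast
  qed
  then have "N - a i \<le> card L"
    using card_mono[of "a ` L" "{a i..<N}"] card_image_le[of L a] by (simp add: L_def)
  moreover have "card {i' \<in> repeated. i \<le> i'} + card L = N - i"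
  proof -
    have "{i' \<in> repeated. i \<le> i'} \<union> L = {i..<N}" by (auto simp: L_def repeated_def)
    moreover have "{i' \<in> repeated. i \<le> i'} \<inter> L = {}" by (auto simp: L_def)
    ultimately show ?thesis
      using card_Un_disjoint[of "{i' \<in> repeated. i \<le> i'}" L] finite_repeated by (simp add: L_def)
  qed
  ultimately show ?thesis using bound[OF assms] assms by linarith
qed

text \<open>Rows that are not repeated have distinct values, so at most \<open>N - Suc s\<close> of
  them exceed \<open>s\<close>; this is exactly the surplus in \<open>card_tail\<close>.\<close>

lemma diag_le_card_repeated: "diag a s \<le> card {i \<in> repeated. s < a i}"
proof -
  define L where "L = {i. i < N \<and> s < a i \<and> i \<notin> repeated}"
  have "inj_on a L"
    by (rule inj_onI) (auto simp: L_def repeated_def, metis linorder_neqE_nat)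
  moreover have "a ` L \<subseteq> {s<..<N}" using bound by (auto simp: L_def)
  ultimately have "card L \<le> N - Suc s"
    using card_inj_on_le[of a L "{s<..<N}"] by simp
  moreover have "card {i. i < N \<and> s < a i} = card {i \<in> repeated. s < a i} + card L"
  proof -
    have "{i. i < N \<and> s < a i} = {i \<in> repeated. s < a i} \<union> L" by (auto simp: L_def repeated_def)
    then show ?thesis
      by (simp add: card_Un_disjoint finite_repeated L_def disjoint_iff)
  qed
  ultimately show ?thesis using card_tail[of s] by linarith
qed

text \<open>The bound for the tail cardinalities lets the corner in the row of \<open>S\<close> that is \<open>c\<close>-th from below
  be placed in column \<open>c\<close>; subtracting the columns costs the term \<open>\<Sum>{..<k}\<close>.\<close>

lemma ex_corner_rows:
  assumes "k \<le> diag a (k - 1)"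
  shows "\<exists>S. finite S \<and> card S = k \<and> (\<forall>i\<in>S. card {i' \<in> S. i \<le> i'} + i \<le> a i) \<and>
    (\<Sum>s<N. min k (diag a s)) + \<Sum>{..<k} \<le> sum a S"
proof -
  have kT: "k \<le> card {i \<in> repeated. s < a i}" if "s < k" for s
  proof -
    have "k \<le> card {i \<in> repeated. k - 1 < a i}"
      using assms diag_le_card_repeated[of "k - 1"] by simp
    also have "\<dots> \<le> card {i \<in> repeated. s < a i}"
      using that finite_repeated by (intro card_mono) auto
    finally show ?thesis .
  qed
  have "k \<le> card repeated"
  proof -
    have "diag a (k - 1) \<le> card repeated"
      using diag_le_card_repeated[of "k - 1"] card_mono[OF finite_repeated, of "{i \<in> repeated. k - 1 < a i}"]
      by auto
    with assms show ?thesis by simp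
  qed
  then obtain S where S: "S \<subseteq> repeated" "card S = k"
    "\<And>s. min k (card {i \<in> repeated. s < a i}) \<le> card {i \<in> S. s < a i}"
    using top_subset[OF finite_repeated, of k a] by auto
  have fS: "finite S" using S(1) finite_repeated finite_subset by blast
  have SN: "i < N" if "i \<in> S" for i using S(1) that by (auto simp: repeated_def)
  have "card {i' \<in> S. i \<le> i'} + i \<le> a i" if "i \<in> S" for i
  proof -
    have "card {i' \<in> S. i \<le> i'} \<le> card {i' \<in> repeated. i \<le> i'}"
      using S(1) finite_repeated by (intro card_mono) auto
    then show ?thesis using card_repeated_ge[OF SN[OF that]] by simp
  qed
  moreover have "(\<Sum>s<N. min k (diag a s)) + \<Sum>{..<k} \<le> sum a S"
  proof -
    have "k \<le> N"
      using S(2) SN card_mono[of "{..<N}" S] by auto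
    \<comment> \<open>The cost of the columns is distributed over the antidiagonals,
      \<open>k - Suc s\<close> going to antidiagonal \<open>s\<close>.\<close>
    have "\<Sum>{..<k} = (\<Sum>s<k. k - Suc s)"
      using sum.nat_diff_reindex[of "\<lambda>s. s" k] by simp
    also have "\<dots> = (\<Sum>s<N. k - Suc s)"
      using \<open>k \<le> N\<close> by (intro sum.mono_neutral_left) auto
    finally have "(\<Sum>s<N. min k (diag a s)) + \<Sum>{..<k} = (\<Sum>s<N. min k (diag a s) + (k - Suc s))"
      by (simp add: sum.distrib)
    also have "\<dots> \<le> (\<Sum>s<N. card {i \<in> S. s < a i})"
    proof (rule sum_mono)
      fix s
      \<comment> \<open>For \<open>s < k\<close> the left side is at most
        \<open>Suc s + (k - Suc s) = k\<close>, and all \<open>k\<close> rows of \<open>S\<close>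
        exceed \<open>s\<close> by \<open>kT\<close>. For \<open>s \<ge> k\<close> the second
        summand is 0.\<close>
      show "min k (diag a s) + (k - Suc s) \<le> card {i \<in> S. s < a i}"
        using S(3)[of s] kT[of s] diag_le[of a s] diag_le_card_repeated[of s] by linarith
    qed
    also have "\<dots> = (\<Sum>s<N. \<Sum>i\<in>S. if s < a i then 1 else 0)"
      using fS by (simp add: sum.If_cases Int_def)
    also have "\<dots> = (\<Sum>i\<in>S. \<Sum>s<N. if s < a i then 1 else 0)"
      by (rule sum.swap)
    also have "\<dots> = sum a S"
    proof (rule sum.cong)
      fix i assume "i \<in> S"
      then have "{s. s < N \<and> s < a i} = {..<a i}" using bound[OF SN[of i]] by auto
      then show "(\<Sum>s<N. if s < a i then 1 else 0) = a i"
        by (simp add: sum.If_cases Int_def)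
    qed simp
    finally show ?thesis .
  qed
  ultimately show ?thesis using fS S(2) by blast
qed

section \<open>Recovering the antidiagonals from the weights\<close>

lemma diag_pred:
  assumes "diag a (Suc s) \<le> Suc s"
  shows "diag a (Suc s) \<le> diag a s"
proof -
  let ?A = "{i. i \<le> Suc s \<and> Suc s < a i}" and ?B = "{i. i \<le> s \<and> s < a i}"
  have fin: "finite ?A" "finite ?B" by auto
  have sub: "?A - {Suc s} \<subseteq> ?B" by auto
  show ?thesis
  proof (cases "Suc s < a (Suc s)")
    case False
    then have "?A \<subseteq> ?B" using le_Suc_eq by fastforce
    then show ?thesis unfolding diag_def by (intro card_mono fin)
  next
    case True
    \<comment> \<open>Moving boxes one column to the left fails only for the box in column 0, in row
      \<open>Suc s\<close>. Since the antidiagonal \<open>Suc s\<close> is not full, some row misses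
      it, and between that row and row \<open>Suc s\<close> there is a row \<open>m\<close> ending
      exactly on antidiagonal \<open>s\<close>, which serves as a replacement.\<close>
    obtain i0 where i0: "i0 \<le> Suc s" "a i0 \<le> Suc s"
      using assms diag_full_iff[of "Suc s" a] by (metis not_less not_less_eq_eq)
    then obtain m where m: "m \<le> Suc s" "a m = Suc s"
      using intermediate[of i0 "Suc s" "Suc s"] True by auto
    with True have "m \<noteq> Suc s" by auto
    with m have "m \<in> ?B" "m \<notin> ?A" by auto
    then have "insert m (?A - {Suc s}) \<subseteq> ?B" using sub by auto
    then have "card (insert m (?A - {Suc s})) \<le> card ?B" by (intro card_mono fin)
    moreover have "card (insert m (?A - {Suc s})) = card ?A"
      using \<open>m \<notin> ?A\<close> fin(1) card_Suc_Diff1[OF fin(1), of "Suc s"] True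
      by (subst card_insert_disjoint) auto
    ultimately show ?thesis by (simp add: diag_def)
  qed
qed

text \<open>Descend one antidiagonal at a time. Below a full antidiagonal \<open>Suc n\<close> lies
  a full one, with \<open>Suc n \<ge> k\<close> boxes because \<open>k - 1 \<le> n\<close>; in the
  other case \<open>diag_pred\<close> applies.\<close>

lemma diag_ge_down:
  assumes "k \<le> diag a s" "k - 1 \<le> t" "t \<le> s"
  shows "k \<le> diag a t"
  using assms(3,1,2)
proof (induction s rule: dec_induct)
  case base
  then show ?case by simp
next
  case (step n)
  have "k \<le> diag a n"
  proof (cases "diag a (Suc n) \<le> Suc n")
    case True
    with diag_pred[of n] step.prems show ?thesis by simp
  next
    case False
    then have "Suc n \<le> diag a n" by (simp add: diag_full_pred)
    with step.hyps step.prems show ?thesis by linarith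
  qed
  with step show ?case by simp
qed

text \<open>The value of the maximal weight, with 0 if no \<open>k\<close> nested L's exist. For
  \<open>k = 0\<close> the condition holds and the sum is 0.\<close>

definition total :: "nat \<Rightarrow> nat" where
  "total k = (if k \<le> diag a (k - 1) then \<Sum>s<N. min k (diag a s) else 0)"

text \<open>\<open>total k - total (k - 1)\<close> is the cardinality of the interval \<open>{s. k \<le> diag a s}\<close>.\<close>

lemma diag_ge_iff_total:
  assumes "1 \<le> k"
  shows "k \<le> diag a s \<longleftrightarrow> 0 < total k \<and> k - 1 \<le> s \<and> s < k - 1 + (total k - total (k - 1))"
proof (cases "k \<le> diag a (k - 1)")
  case False
  then have "\<not> k \<le> diag a s"
    using diag_ge_down[of k s "k - 1"] diag_le[of a s] by fastforce
  then show ?thesis using False by (simp add: total_def)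
next
  case True
  let ?D = "{s. k \<le> diag a s}"
  have DN: "?D \<subseteq> {..<N}" using assms diag_eq_0 by (auto simp: not_less intro: ccontr)
  then have fin: "finite ?D" by (rule finite_subset) simp
  have "k - 1 < N" using DN True by auto
  \<comment> \<open>This ensures that \<open>total (k - 1)\<close> is the actual sum and not the
    default 0.\<close>
  have "k - 1 \<le> diag a (k - 1 - 1)"
  proof -
    show ?thesis
    proof (cases "k = 1")
      case False
      then have "k = Suc (Suc (k - 2))" using assms by simp
      then obtain n where "k = Suc (Suc n)" by blast
      then show ?thesis using True diag_full_pred[of n a] by simp
    qed simp
  qed
  then have "total (k - 1) + card ?D = (\<Sum>s<N. min (k - 1) (diag a s)) + (\<Sum>s<N. if k \<le> diag a s then 1 else 0)"
    using DN by (simp add: total_def sum.If_cases Int_absorb1)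
  \<comment> \<open>Raising the cap from \<open>k - 1\<close> to \<open>k\<close> adds 1 exactly at
    those \<open>s\<close> with \<open>k \<le> diag a s\<close>.\<close>
  also have "\<dots> = (\<Sum>s<N. min k (diag a s))"
    unfolding sum.distrib[symmetric] using assms by (intro sum.cong) auto
  finally have diff: "total k - total (k - 1) = card ?D"
    using True by (simp add: total_def)
  have "k - 1 \<in> ?D" using True by simp
  then have "0 < card ?D" using fin by (auto simp: card_gt_0_iff)
  then have pos: "0 < total k" using diff by simp
  have "Max ?D \<in> ?D" using fin \<open>k - 1 \<in> ?D\<close> by (intro Max_in) auto
  have "?D = {k - 1..Max ?D}"
  proof (intro equalityI subsetI)
    fix t assume "t \<in> ?D"
    then show "t \<in> {k - 1..Max ?D}" using fin diag_le[of a t] by auto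
  next
    fix t assume "t \<in> {k - 1..Max ?D}"
    then show "t \<in> ?D" using \<open>Max ?D \<in> ?D\<close> diag_ge_down[of k "Max ?D" t] by simp
  qed
  moreover from this have "card ?D = Suc (Max ?D) - (k - 1)"
    by (metis card_atLeastAtMost)
  moreover have "k - 1 \<le> Max ?D" using fin \<open>k - 1 \<in> ?D\<close> by simp
  ultimately have "s \<in> ?D \<longleftrightarrow> k - 1 \<le> s \<and> s < k - 1 + card ?D"
    by (metis (no_types, lifting) add_diff_inverse_nat atLeastAtMost_iff le_SucI less_Suc_eq_le not_less)
  then show ?thesis using pos diff by simp
qed

end

subsection \<open>Nested L's\<close>

definition row :: "nat list \<Rightarrow> nat \<Rightarrow> nat" where
  "row \<mu> i = (if i < length \<mu> then \<mu> ! i else 0)"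

definition shifted_row :: "nat list \<Rightarrow> nat \<Rightarrow> nat" where
  "shifted_row \<mu> i = row \<mu> i + i"

lemma ferrers_eq_row: "ferrers \<mu> = {(Suc i, Suc j) | i j. j < row \<mu> i}"
proof -
  have "x \<in> ferrers \<mu> \<longleftrightarrow> x \<in> {(Suc i, Suc j) | i j. j < row \<mu> i}" for x
  proof (cases x)
    case (Pair p q)
    show ?thesis
      unfolding Pair by (cases p; cases q) (auto simp: ferrers_def row_def)
  qed
  then show ?thesis by blast
qed

lemma row_antimono:
  assumes "is_partition \<mu>" "i \<le> i'"
  shows "row \<mu> i' \<le> row \<mu> i"
proof (cases "i < i' \<and> i' < length \<mu>")
  case True
  then have "\<mu> ! i' \<le> \<mu> ! i"
    using assms(1) sorted_wrt_nth_less[of "(\<ge>)" \<mu> i i'] by (simp add: is_partition_def)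
  then show ?thesis using True by (simp add: row_def)
next
  case False
  then show ?thesis using assms(2) by (auto simp: row_def)
qed

lemma shifted_rows_shifted_row:
  assumes "is_partition \<mu>" "row \<mu> 0 + length \<mu> \<le> N"
  shows "shifted_rows (shifted_row \<mu>) N"
proof
  fix i
  show "shifted_row \<mu> (Suc i) \<le> Suc (shifted_row \<mu> i)"
    using row_antimono[OF assms(1), of i "Suc i"] by (simp add: shifted_row_def)
  show "i \<le> shifted_row \<mu> i"
    by (simp add: shifted_row_def)
  show "shifted_row \<mu> i = i" if "N \<le> i"
    using that assms(2) by (simp add: shifted_row_def row_def)
  show "shifted_row \<mu> i < N" if "i < N"
  proof (cases "i < length \<mu>")
    case True
    then show ?thesis
      using row_antimono[OF assms(1), of 0 i] assms(2) unfolding shifted_row_def by linarith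
  qed (simp add: that shifted_row_def row_def)
qed

text \<open>The arm with the corner has \<open>row \<mu> i - j\<close> boxes. Higher rows are at
  least as long, so the leg above the corner is complete and adds \<open>i\<close>.\<close>

lemma card_L_shape:
  assumes "is_partition \<mu>" "j < row \<mu> i"
  shows "card (L_shape \<mu> (Suc i, Suc j)) = shifted_row \<mu> i - j"
proof -
  have up: "j < row \<mu> y" if "y < i" for y
    using row_antimono[OF assms(1), of y i] that assms(2) by simp
  have "L_shape \<mu> (Suc i, Suc j) =
      (\<lambda>x. (Suc i, Suc x)) ` {j..<row \<mu> i} \<union> (\<lambda>y. (Suc y, Suc j)) ` {..<i}" (is "_ = ?A \<union> ?B")
  proof (intro equalityI subsetI)
    fix x assume "x \<in> L_shape \<mu> (Suc i, Suc j)"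
    then consider x' where "x = (Suc i, Suc x')" "j \<le> x'" "x' < row \<mu> i"
      | y where "x = (Suc y, Suc j)" "y \<le> i"
      by (auto simp: L_shape_def ferrers_eq_row)
    then show "x \<in> ?A \<union> ?B"
    proof cases
      case 2
      then show ?thesis using assms(2) by (cases "y = i") auto
    qed auto
  qed (auto simp: L_shape_def ferrers_eq_row up)
  moreover have "?A \<inter> ?B = {}" by auto
  moreover have "card ?A = row \<mu> i - j" "card ?B = i"
    by (simp_all add: card_image inj_on_def)
  ultimately show ?thesis
    using assms(2) by (simp add: card_Un_disjoint shifted_row_def)
qed

text \<open>Passes from lists of L's to coordinates counted from 0: \<open>r c\<close> and
  \<open>q c\<close> are the row and column of the \<open>c\<close>-th corner.\<close>

lemma nested_Ls_iff:
  assumes "is_partition \<mu>"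
  shows "(\<exists>Ls. nested_Ls \<mu> Ls \<and> length Ls = k \<and> nested_weight Ls = w) \<longleftrightarrow>
    (\<exists>r q. (\<forall>d<k. \<forall>c<d. r d < r c \<and> q c < q d) \<and> (\<forall>c<k. q c < row \<mu> (r c)) \<and>
      w = (\<Sum>c<k. shifted_row \<mu> (r c) - q c))"
proof
  assume "\<exists>Ls. nested_Ls \<mu> Ls \<and> length Ls = k \<and> nested_weight Ls = w"
  then obtain cs where cs: "set cs \<subseteq> ferrers \<mu>" "length cs = k"
    "sorted_wrt (\<lambda>a b. fst b < fst a \<and> snd a < snd b) cs"
    "w = nested_weight (map (L_shape \<mu>) cs)"
    unfolding nested_Ls_def by auto
  define r where "r c = fst (cs ! c) - 1" for c
  define q where "q c = snd (cs ! c) - 1" for c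
  have nth: "cs ! c = (Suc (r c), Suc (q c)) \<and> q c < row \<mu> (r c)" if "c < k" for c
  proof -
    have "cs ! c \<in> ferrers \<mu>" using cs(1,2) that by auto
    then show ?thesis by (auto simp: r_def q_def ferrers_eq_row)
  qed
  have "r d < r c \<and> q c < q d" if "d < k" "c < d" for c d
    using sorted_wrt_nth_less[OF cs(3), of c d] that cs(2) nth[of c] nth[of d] by simp
  moreover have "w = (\<Sum>c<k. shifted_row \<mu> (r c) - q c)"
    unfolding cs(4) nested_weight_def
    by (simp add: sum_list_sum_nth atLeast0LessThan cs(2) nth card_L_shape[OF assms])
  ultimately show "\<exists>r q. (\<forall>d<k. \<forall>c<d. r d < r c \<and> q c < q d) \<and> (\<forall>c<k. q c < row \<mu> (r c)) \<and>
      w = (\<Sum>c<k. shifted_row \<mu> (r c) - q c)"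
    using nth by blast
next
  assume "\<exists>r q. (\<forall>d<k. \<forall>c<d. r d < r c \<and> q c < q d) \<and> (\<forall>c<k. q c < row \<mu> (r c)) \<and>
      w = (\<Sum>c<k. shifted_row \<mu> (r c) - q c)"
  then obtain r q where rq: "\<And>c d. d < k \<Longrightarrow> c < d \<Longrightarrow> r d < r c \<and> q c < q d"
    "\<And>c. c < k \<Longrightarrow> q c < row \<mu> (r c)" "w = (\<Sum>c<k. shifted_row \<mu> (r c) - q c)"
    by blast
  define cs where "cs = map (\<lambda>c. (Suc (r c), Suc (q c))) [0..<k]"
  have "sorted_wrt (\<lambda>a b. fst b < fst a \<and> snd a < snd b) cs"
    unfolding sorted_wrt_iff_nth_less using rq(1) by (simp add: cs_def)
  moreover have "set cs \<subseteq> ferrers \<mu>"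
    using rq(2) by (auto simp: cs_def ferrers_eq_row)
  ultimately have "nested_Ls \<mu> (map (L_shape \<mu>) cs)"
    unfolding nested_Ls_def by blast
  moreover have "nested_weight (map (L_shape \<mu>) cs) = w"
    by (simp add: nested_weight_def sum_list_sum_nth atLeast0LessThan cs_def rq(2,3) card_L_shape[OF assms])
  moreover have "length (map (L_shape \<mu>) cs) = k"
    by (simp add: cs_def)
  ultimately show "\<exists>Ls. nested_Ls \<mu> Ls \<and> length Ls = k \<and> nested_weight Ls = w"
    by blast
qed

lemma
  assumes \<mu>: "is_partition \<mu>"
    and N: "shifted_rows (shifted_row \<mu>) N"
    and mono: "\<And>c d. d < k \<Longrightarrow> c < d \<Longrightarrow> r d < r c \<and> q c < q d"
    and mem: "\<And>c. c < k \<Longrightarrow> q c < row \<mu> (r c)"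
  shows staircase_of_nested: "k \<le> diag (shifted_row \<mu>) (k - 1)"
    and nested_sum_le: "(\<Sum>c<k. shifted_row \<mu> (r c) - q c) \<le> (\<Sum>s<N. min k (diag (shifted_row \<mu>) s))"
proof -
  let ?a = "shifted_row \<mu>"
  have q_ge: "c < k \<Longrightarrow> c \<le> q c" for c
  proof (induction c)
    case (Suc c)
    then show ?case using mono[of "Suc c" c] by simp
  qed simp
  have r_ge: "d < k \<Longrightarrow> d \<le> r (k - 1 - d)" for d
  proof (induction d)
    case (Suc d)
    then have "r (k - 1 - d) < r (k - 1 - Suc d)" using mono[of "k - 1 - d" "k - 1 - Suc d"] by simp
    then show ?case using Suc by simp
  qed simp
  show "k \<le> diag ?a (k - 1)"
  proof (cases k)
    case (Suc n)
    have "n < ?a i" if "i \<le> n" for i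
    proof -
      \<comment> \<open>The corner with index \<open>n - i\<close> lies in row \<open>i\<close> or
        further down and in column \<open>n - i\<close> or further right, so row \<open>i\<close>
        reaches past column \<open>n - i\<close>.\<close>
      have "n - i < row \<mu> (r (n - i))" using mem[of "n - i"] q_ge[of "n - i"] Suc by linarith
      also have "\<dots> \<le> row \<mu> i"
        using row_antimono[OF \<mu>] r_ge[of i] that Suc by simp
      finally show ?thesis using that by (simp add: shifted_row_def)
    qed
    then show ?thesis using Suc diag_full_iff[of n ?a] by simp
  qed simp
  have rN: "?a (r c) < N" if "c < k" for c
  proof (rule shifted_rows.bound[OF N], rule ccontr)
    assume "\<not> r c < N"
    then have "row \<mu> (r c) = 0"
      using shifted_rows.tail[OF N, of "r c"] by (simp add: shifted_row_def)
    then show False using mem[OF that] by simp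
  qed
  \<comment> \<open>Double counting: each L has one box on every antidiagonal \<open>s\<close> with
    \<open>q c \<le> s < ?a (r c)\<close>.\<close>
  have "(\<Sum>c<k. ?a (r c) - q c) = (\<Sum>c<k. \<Sum>s<N. if q c \<le> s \<and> s < ?a (r c) then 1 else 0)"
  proof (rule sum.cong)
    fix c assume "c \<in> {..<k}"
    then have "{s. s < N \<and> q c \<le> s \<and> s < ?a (r c)} = {q c..<?a (r c)}"
      using rN[of c] by auto
    then show "?a (r c) - q c = (\<Sum>s<N. if q c \<le> s \<and> s < ?a (r c) then 1 else 0)"
      by (simp add: sum.If_cases Int_def)
  qed simp
  also have "\<dots> = (\<Sum>s<N. \<Sum>c<k. if q c \<le> s \<and> s < ?a (r c) then 1 else 0)"
    by (rule sum.swap)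
  also have "\<dots> = (\<Sum>s<N. card {c. c < k \<and> q c \<le> s \<and> s < ?a (r c)})"
    by (simp add: sum.If_cases Int_def)
  also have "\<dots> \<le> (\<Sum>s<N. min k (diag ?a s))"
  proof (rule sum_mono)
    fix s
    let ?C = "{c. c < k \<and> q c \<le> s \<and> s < ?a (r c)}"
    \<comment> \<open>the row in which the L with corner \<open>(r c, q c)\<close> meets the antidiagonal \<open>s\<close>\<close>
    define box_row where "box_row c = min (r c) (s - q c)" for c
    \<comment> \<open>Both arguments of the minimum strictly decrease from \<open>c\<close> to
      \<open>d\<close>; for the second one, \<open>q d \<le> s\<close> rules out truncation.\<close>
    have less: "box_row d < box_row c" if "c \<in> ?C" "d \<in> ?C" "c < d" for c d
      using mono[of d c] that by (auto simp: box_row_def)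
    have "inj_on box_row ?C"
    proof (rule inj_onI)
      fix c d assume "c \<in> ?C" "d \<in> ?C" "box_row c = box_row d"
      then show "c = d" using less[of c d] less[of d c] by (cases c d rule: linorder_cases) auto
    qed
    moreover have "box_row ` ?C \<subseteq> {i. i \<le> s \<and> s < ?a i}"
    proof
      fix i assume "i \<in> box_row ` ?C"
      then obtain c where c: "c < k" "q c \<le> s" "s < ?a (r c)" "i = box_row c" by auto
      \<comment> \<open>If the minimum is \<open>s - q c\<close>, the box is in column
        \<open>q c\<close>, and row \<open>i\<close> contains it because it is at least as long as
        row \<open>r c\<close>. Otherwise \<open>i = r c\<close>, and \<open>s < ?a (r c)\<close>
        suffices.\<close>
      have "row \<mu> (r c) \<le> row \<mu> i"
        by (rule row_antimono[OF \<mu>]) (simp add: c(4) box_row_def)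
      moreover have "q c < row \<mu> (r c)" using mem c(1) by simp
      ultimately show "i \<in> {i. i \<le> s \<and> s < ?a i}"
        using c by (auto simp: box_row_def min_def shifted_row_def)
    qed
    ultimately have "card ?C \<le> diag ?a s"
      unfolding diag_def by (intro card_inj_on_le) auto
    moreover have "card ?C \<le> k"
      using card_mono[of "{..<k}" ?C] by auto
    ultimately show "card ?C \<le> min k (diag ?a s)" by simp
  qed
  finally show "(\<Sum>c<k. ?a (r c) - q c) \<le> (\<Sum>s<N. min k (diag ?a s))" .
qed

text \<open>The rows from \<open>ex_corner_rows\<close>, taken from the bottom up, receive the
  columns 0, ..., \<open>k - 1\<close>; the subtracted columns cancel the extra term
  \<open>\<Sum>{..<k}\<close> there.\<close>

lemma ex_nested_sum_ge:
  assumes \<mu>: "is_partition \<mu>"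
    and N: "shifted_rows (shifted_row \<mu>) N"
    and k: "k \<le> diag (shifted_row \<mu>) (k - 1)"
  shows "\<exists>r. (\<forall>d<k. \<forall>c<d. r d < r c) \<and> (\<forall>c<k. c < row \<mu> (r c)) \<and>
    (\<Sum>s<N. min k (diag (shifted_row \<mu>) s)) \<le> (\<Sum>c<k. shifted_row \<mu> (r c) - c)"
proof -
  let ?a = "shifted_row \<mu>"
  obtain S where S: "finite S" "card S = k" "\<And>i. i \<in> S \<Longrightarrow> card {i' \<in> S. i \<le> i'} + i \<le> ?a i"
    "(\<Sum>s<N. min k (diag ?a s)) + \<Sum>{..<k} \<le> sum ?a S"
    using shifted_rows.ex_corner_rows[OF N k] by blast
  define rs where "rs = rev (sorted_list_of_set S)"
  have rs: "set rs = S" "distinct rs" "length rs = k"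
    using S(1,2) by (simp_all add: rs_def)
  have "sorted_wrt (\<lambda>x y. y < x) rs"
    by (simp add: rs_def sorted_wrt_rev strict_sorted_list_of_set)
  then have mono: "rs ! d < rs ! c" if "d < k" "c < d" for c d
    using sorted_wrt_nth_less[of "\<lambda>x y. y < x" rs c d] that rs(3) by simp
  have mem: "c < row \<mu> (rs ! c)" if "c < k" for c
  proof -
    \<comment> \<open>As \<open>rs\<close> is decreasing, its first \<open>Suc c\<close> entries are
      rows of \<open>S\<close> not above \<open>rs ! c\<close>, so this row has more than
      \<open>c\<close> boxes.\<close>
    have "(!) rs ` {..c} \<subseteq> {i' \<in> S. rs ! c \<le> i'}"
      using mono[OF that] that rs(1,3) by (auto simp: le_less)
    moreover have "inj_on ((!) rs) {..c}"
      using rs(2,3) that by (auto simp: inj_on_def nth_eq_iff_index_eq)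
    ultimately have "Suc c \<le> card {i' \<in> S. rs ! c \<le> i'}"
      using card_inj_on_le[of "(!) rs" "{..c}" "{i' \<in> S. rs ! c \<le> i'}"] S(1) by simp
    moreover have "rs ! c \<in> S" using rs(1,3) that nth_mem by blast
    ultimately show ?thesis using S(3)[of "rs ! c"] by (simp add: shifted_row_def)
  qed
  have "sum ?a S = sum_list (map ?a rs)"
    using rs(1,2) by (simp add: sum_list_distinct_conv_sum_set)
  also have "\<dots> = (\<Sum>c<k. ?a (rs ! c))"
    by (simp add: sum_list_sum_nth atLeast0LessThan rs(3))
  also have "\<dots> = (\<Sum>c<k. ?a (rs ! c) - c + c)"
  proof (rule sum.cong)
    fix c assume "c \<in> {..<k}"
    then show "?a (rs ! c) = ?a (rs ! c) - c + c"
      using mem[of c] by (simp add: shifted_row_def)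
  qed simp
  finally have "(\<Sum>s<N. min k (diag ?a s)) \<le> (\<Sum>c<k. ?a (rs ! c) - c)"
    using S(4) by (simp add: sum.distrib)
  then show ?thesis using mono mem by (intro exI[of _ "(!) rs"]) auto
qed

lemma max_nested_weight_eq_total:
  assumes \<mu>: "is_partition \<mu>" and N: "shifted_rows (shifted_row \<mu>) N"
  shows "max_nested_weight k \<mu> = shifted_rows.total (shifted_row \<mu>) N k"
proof -
  let ?a = "shifted_row \<mu>"
  let ?T = "\<Sum>s<N. min k (diag ?a s)"
  define W where "W = {nested_weight Ls | Ls. nested_Ls \<mu> Ls \<and> length Ls = k}"
  have W_iff: "w \<in> W \<longleftrightarrow> (\<exists>r q. (\<forall>d<k. \<forall>c<d. r d < r c \<and> q c < q d) \<and> (\<forall>c<k. q c < row \<mu> (r c)) \<and>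
      w = (\<Sum>c<k. ?a (r c) - q c))" for w
    unfolding nested_Ls_iff[OF \<mu>, symmetric] W_def by blast
  have upper: "k \<le> diag ?a (k - 1) \<and> w \<le> ?T" if "w \<in> W" for w
  proof -
    obtain r q where rq: "\<And>c d. d < k \<Longrightarrow> c < d \<Longrightarrow> r d < r c \<and> q c < q d"
      "\<And>c. c < k \<Longrightarrow> q c < row \<mu> (r c)" "w = (\<Sum>c<k. ?a (r c) - q c)"
      using \<open>w \<in> W\<close> unfolding W_iff by blast
    show ?thesis
      using staircase_of_nested[OF \<mu> N rq(1,2)] nested_sum_le[OF \<mu> N rq(1,2)] rq(3) by simp
  qed
  have max: "max_nested_weight k \<mu> = (if W = {} then 0 else Max W)"
    by (simp only: max_nested_weight_def W_def Let_def)
  show ?thesis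
  proof (cases "k \<le> diag ?a (k - 1)")
    case False
    then have "W = {}" using upper by blast
    with False show ?thesis by (simp add: max shifted_rows.total_def[OF N])
  next
    case True
    obtain r where r: "\<forall>d<k. \<forall>c<d. r d < r c" "\<forall>c<k. c < row \<mu> (r c)"
      "?T \<le> (\<Sum>c<k. ?a (r c) - c)"
      using ex_nested_sum_ge[OF \<mu> N True] by blast
    have "(\<Sum>c<k. ?a (r c) - c) \<in> W"
      unfolding W_iff using r by (intro exI[of _ r] exI[of _ "\<lambda>c. c"]) auto
    with r(3) upper have "?T \<in> W" by (metis le_antisym)
    moreover have "finite W"
      using upper by (intro finite_subset[of W "{..?T}"]) auto
    ultimately have "Max W = ?T"
      using upper by (intro Max_eqI) auto
    then show ?thesis
      using True \<open>?T \<in> W\<close> by (auto simp: max shifted_rows.total_def[OF N])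
  qed
qed

lemma diag_eq_iff_total_eq:
  assumes "shifted_rows a N" "shifted_rows b N"
  shows "(\<forall>s. diag a s = diag b s) \<longleftrightarrow>
    (\<forall>k\<ge>1. shifted_rows.total a N k = shifted_rows.total b N k)"
proof
  assume "\<forall>s. diag a s = diag b s"
  then show "\<forall>k\<ge>1. shifted_rows.total a N k = shifted_rows.total b N k"
    by (simp add: assms shifted_rows.total_def)
next
  assume eq: "\<forall>k\<ge>1. shifted_rows.total a N k = shifted_rows.total b N k"
  \<comment> \<open>The case \<open>k = 0\<close> is included because
    \<open>diag_ge_iff_total\<close> at 1 refers to \<open>total 0\<close>, which is 0 for
    both.\<close>
  have "shifted_rows.total a N k = shifted_rows.total b N k" for k
    using eq by (cases "k = 0") (simp_all add: assms shifted_rows.total_def[where k = 0])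
  then have "k \<le> diag a s \<longleftrightarrow> k \<le> diag b s" if "1 \<le> k" for k s
    using shifted_rows.diag_ge_iff_total[OF assms(1) that] shifted_rows.diag_ge_iff_total[OF assms(2) that]
    by simp
  then have "k \<le> diag a s \<longleftrightarrow> k \<le> diag b s" for k s
    by (cases k) auto
  then show "\<forall>s. diag a s = diag b s"
    by (metis order_refl le_antisym)
qed

section \<open>Padding to a common number of rows, and the conclusion\<close>

lemma ferrers_append_zeros: "ferrers (\<mu> @ replicate n 0) = ferrers \<mu>"
  unfolding ferrers_eq_row by (simp add: row_def nth_append)

lemma rook_equivalent_iff_diag:
  assumes \<mu>: "is_partition \<mu>" and \<nu>: "is_partition \<nu>"
    and len: "length \<mu> \<le> N" "length \<nu> \<le> N"
    and N: "shifted_rows (shifted_row \<mu>) N" "shifted_rows (shifted_row \<nu>) N"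
  shows "rook_equivalent \<mu> \<nu> \<longleftrightarrow> (\<forall>s. diag (shifted_row \<mu>) s = diag (shifted_row \<nu>) s)"
proof -
  define pad where "pad \<kappa> = \<kappa> @ replicate (N - length \<kappa>) 0" for \<kappa> :: "nat list"
  have rook: "rook_number (pad \<kappa>) k = rook_number \<kappa> k" for \<kappa> k
    by (simp add: rook_number_def pad_def ferrers_append_zeros)
  have sorted: "sorted_wrt (\<ge>) (pad \<kappa>)" if "is_partition \<kappa>" for \<kappa>
  proof -
    have "sorted_wrt (\<ge>) (replicate n (0 :: nat))" for n by (induction n) auto
    then show ?thesis
      using that by (simp add: pad_def is_partition_def sorted_wrt_append)
  qed
  have pad: "pad \<kappa> ! i + i = shifted_row \<kappa> i" if "i < N" for \<kappa> i
    using that by (auto simp: pad_def nth_append shifted_row_def row_def)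
  have mset: "image_mset (\<lambda>i. pad \<kappa> ! i + i) (mset_set {..<N}) = image_mset (shifted_row \<kappa>) (mset_set {..<N})"
    for \<kappa>
    by (intro image_mset_cong) (simp add: pad)
  have "rook_equivalent \<mu> \<nu> \<longleftrightarrow> rook_equivalent (pad \<mu>) (pad \<nu>)"
    by (simp add: rook_equivalent_def rook)
  also have "\<dots> \<longleftrightarrow>
      image_mset (shifted_row \<mu>) (mset_set {..<N}) = image_mset (shifted_row \<nu>) (mset_set {..<N})"
    using rook_equivalent_iff_mset[OF sorted[OF \<mu>] sorted[OF \<nu>], of N] len by (simp add: mset) (simp add: pad_def)
  also have "\<dots> \<longleftrightarrow> (\<forall>s. diag (shifted_row \<mu>) s = diag (shifted_row \<nu>) s)"
    by (simp add: image_mset_eq_iff_tails shifted_rows.card_tail[OF N(1)] shifted_rows.card_tail[OF N(2)])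
  finally show ?thesis .
qed

theorem theorem11:
  fixes \<mu> \<nu> :: "nat list"
  assumes "is_partition \<mu>" and "is_partition \<nu>"
  shows "rook_equivalent \<mu> \<nu> \<longleftrightarrow>
    (\<forall>k \<ge> 1. max_nested_weight k \<mu> = max_nested_weight k \<nu>)"
proof -
  \<comment> \<open>Each board needs its first row length plus its number of rows; the sum serves
    both.\<close>
  define N where "N = row \<mu> 0 + length \<mu> + (row \<nu> 0 + length \<nu>)"
  have N: "shifted_rows (shifted_row \<mu>) N" "shifted_rows (shifted_row \<nu>) N"
    using assms by (auto intro!: shifted_rows_shifted_row simp: N_def)
  have "rook_equivalent \<mu> \<nu> \<longleftrightarrow> (\<forall>s. diag (shifted_row \<mu>) s = diag (shifted_row \<nu>) s)"
    using assms N by (intro rook_equivalent_iff_diag) (auto simp: N_def)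
  also have "\<dots> \<longleftrightarrow> (\<forall>k\<ge>1. max_nested_weight k \<mu> = max_nested_weight k \<nu>)"
    using diag_eq_iff_total_eq[OF N]
    by (simp only: max_nested_weight_eq_total[OF assms(1) N(1)] max_nested_weight_eq_total[OF assms(2) N(2)])
  finally show ?thesis .
qed

end
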